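(* The minimum number of monochromatic triangles in a line $2$-coloring of the Young configuration, taken over all line $2$-colorings, is $0$.
   Context: A configuration is a pair $(\mathcal{P},\mathcal{L})$ with $\mathcal{P}$ a finite set of points and $\mathcal{L}$ a finite set of subsets of $\mathcal{P}$ called lines, such that any two distinct points lie together on at most one line, all points are on the same number of lines, all lines contain the same number of points, and there are at least three points. Three points $p_1,p_2,p_3$ form a triangle if there are lines $l_1,l_2,l_3$ with $p_1,p_2\in l_1$, $p_3\notin l_1$; $p_2,p_3\in l_2$, $p_1\notin l_2$; $p_1,p_3\in l_3$, $p_2\notin l_3$. The lines $l_1,l_2,l_3$ are then uniquely determined by the points. A line $2$-coloring assigns to each line one of the colors red, blue. A triangle is monochromatic if its lines $l_1,l_2,l_3$ all have the same color. The Young configuration is the $(9_4,12_3)$-configuration given by the affine plane of order $3$: points $\mathbb{F}_3^2$, lines the $12$ affine lines of $\mathbb{F}_3^2$. *)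

theory Defs
  imports "HOL-Analysis.Analysis"
begin

definition configuration :: "'a set \<Rightarrow> 'a set set \<Rightarrow> bool" where
  "configuration P L \<longleftrightarrow>
     finite P \<and> finite L \<and> (\<forall>l\<in>L. l \<subseteq> P) \<and>
     (\<forall>p\<in>P. \<forall>q\<in>P. p \<noteq> q \<longrightarrow> (\<forall>l\<in>L. \<forall>m\<in>L. {p, q} \<subseteq> l \<and> {p, q} \<subseteq> m \<longrightarrow> l = m)) \<and>
     (\<exists>r. \<forall>p\<in>P. card {l \<in> L. p \<in> l} = r) \<and>
     (\<exists>k. \<forall>l\<in>L. card l = k) \<and>
     3 \<le> card P"

text \<open>The lines l1, l2, l3 witness that p1, p2, p3 form a triangle. The three points are then
  automatically distinct, and in a configuration they determine the lines.\<close>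

definition triangle_lines ::
  "'a set set \<Rightarrow> 'a \<Rightarrow> 'a \<Rightarrow> 'a \<Rightarrow> 'a set \<Rightarrow> 'a set \<Rightarrow> 'a set \<Rightarrow> bool" where
  "triangle_lines L p1 p2 p3 l1 l2 l3 \<longleftrightarrow>
     l1 \<in> L \<and> l2 \<in> L \<and> l3 \<in> L \<and>
     p1 \<in> l1 \<and> p2 \<in> l1 \<and> p3 \<notin> l1 \<and>
     p2 \<in> l2 \<and> p3 \<in> l2 \<and> p1 \<notin> l2 \<and>
     p1 \<in> l3 \<and> p3 \<in> l3 \<and> p2 \<notin> l3"

datatype color = Red | Blue

text \<open>A coloring is a function on the set of lines, made total by \<^const>\<open>undefined\<close> outside it.\<close>

definition line_2_colorings :: "'a set set \<Rightarrow> ('a set \<Rightarrow> color) set" where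
  "line_2_colorings L = L \<rightarrow>\<^sub>E {Red, Blue}"

text \<open>Triangles are unordered, so they are counted as three-element sets of points.\<close>

definition monochromatic_triangles ::
  "'a set \<Rightarrow> 'a set set \<Rightarrow> ('a set \<Rightarrow> color) \<Rightarrow> 'a set set" where
  "monochromatic_triangles P L c =
     {{p1, p2, p3} | p1 p2 p3. p1 \<in> P \<and> p2 \<in> P \<and> p3 \<in> P \<and>
        (\<exists>l1 l2 l3. triangle_lines L p1 p2 p3 l1 l2 l3 \<and> c l1 = c l2 \<and> c l2 = c l3)}"

definition min_monochromatic_triangles :: "'a set \<Rightarrow> 'a set set \<Rightarrow> nat" where
  "min_monochromatic_triangles P L =
     Min ((\<lambda>c. card (monochromatic_triangles P L c)) ` line_2_colorings L)"

text \<open>The numeral type \<^typ>\<open>3\<close> is the ring of integers modulo 3, so \<^typ>\<open>3 ^ 2\<close> is the plane over the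
  field with three elements.\<close>

definition young_points :: "(3 ^ 2) set" where
  "young_points = UNIV"

definition affine_line :: "3 ^ 2 \<Rightarrow> 3 ^ 2 \<Rightarrow> (3 ^ 2) set" where
  "affine_line a v = {a + t *s v | t. True}"

definition young_lines :: "(3 ^ 2) set set" where
  "young_lines = {affine_line a v | a v. v \<noteq> 0}"

lemma line_2_colorings_finite_nonempty:
  assumes "finite L"
  shows "finite (line_2_colorings L)" "line_2_colorings L \<noteq> {}"
  using assms by (auto simp: line_2_colorings_def PiE_eq_empty_iff intro!: finite_PiE)

lemma num3_inverse:
  assumes "(x :: 3) \<noteq> 0"
  shows "x * x = 1"
  using exhaust_3[of x] assms by auto

lemma affine_line_scale:
  assumes "u \<noteq> 0"
  shows "affine_line (a + s *s v) (u *s v) = affine_line a v"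
proof -
  have "a + s *s v + t *s (u *s v) = a + (s + t * u) *s v" for t
    by (simp add: vec_eq_iff algebra_simps)
  moreover have "a + t *s v = a + s *s v + ((t - s) * u) *s (u *s v)" for t
    using num3_inverse[OF assms] by (simp add: vec_eq_iff algebra_simps)
  ultimately show ?thesis unfolding affine_line_def by blast
qed

lemma affine_line_two_points:
  assumes "p \<noteq> q" "p \<in> affine_line a v" "q \<in> affine_line a v"
  shows "affine_line a v = affine_line p (q - p)"
proof -
  obtain s t where s: "p = a + s *s v" and t: "q = a + t *s v"
    using assms by (auto simp: affine_line_def)
  have "q - p = (t - s) *s v"
    unfolding s t by (simp add: vec_eq_iff algebra_simps)
  moreover have "t - s \<noteq> 0" using assms s t by auto
  ultimately show ?thesis using affine_line_scale[of "t - s" a s v] s by metis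
qed

lemma card_affine_line:
  assumes "v \<noteq> 0"
  shows "card (affine_line a v) = 3"
proof -
  have "inj (\<lambda>t. a + t *s v)"
  proof (rule injI)
    fix s t assume "a + s *s v = a + t *s v"
    then have eq: "(s - t) * v $ i = 0" for i
      by (simp add: vec_eq_iff algebra_simps)
    obtain i where "v $ i \<noteq> 0" using assms by (auto simp: vec_eq_iff)
    then have "s - t = (s - t) * v $ i * v $ i"
      using num3_inverse[of "v $ i"] by (simp add: mult.assoc)
    then show "s = t" using eq[of i] by simp
  qed
  moreover have "affine_line a v = range (\<lambda>t. a + t *s v)"
    by (auto simp: affine_line_def)
  ultimately show ?thesis by (simp add: card_image)
qed

lemma affine_line_ends: "p \<in> affine_line p (q - p)" "q \<in> affine_line p (q - p)"
proof -
  have "p = p + 0 *s (q - p)" "q = p + 1 *s (q - p)" by simp_all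
  then show "p \<in> affine_line p (q - p)" "q \<in> affine_line p (q - p)"
    unfolding affine_line_def by blast+
qed

lemma young_line_through:
  assumes "p \<noteq> q"
  shows "{l \<in> young_lines. p \<in> l \<and> q \<in> l} = {affine_line p (q - p)}"
proof -
  have "affine_line p (q - p) \<in> young_lines"
    using assms unfolding young_lines_def by (metis (mono_tags, lifting) eq_iff_diff_eq_0 mem_Collect_eq)
  moreover have "l = affine_line p (q - p)" if "l \<in> young_lines" "p \<in> l" "q \<in> l" for l
    using that affine_line_two_points[OF assms] unfolding young_lines_def by blast
  ultimately show ?thesis using affine_line_ends by blast
qed

lemma card_young_points: "card young_points = 9"
  by (simp add: young_points_def)

lemma card_young_line: "l \<in> young_lines \<Longrightarrow> card l = 3"
  by (auto simp: young_lines_def card_affine_line)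

lemma card_young_lines_through: "card {l \<in> young_lines. p \<in> l} = 4"
proof -
  let ?T = "{l \<in> young_lines. p \<in> l}"
  have "(\<Sum>q\<in>UNIV - {p}. card {l \<in> ?T. q \<in> l}) = 2 * card ?T"
  proof (rule sum_multicount, simp, simp, safe)
    fix l assume "l \<in> young_lines" "p \<in> l"
    moreover have "{q \<in> UNIV - {p}. q \<in> l} = l - {p}" by auto
    ultimately show "card {q \<in> UNIV - {p}. q \<in> l} = 2"
      by (simp add: card_young_line)
  qed
  moreover have "card {l \<in> ?T. q \<in> l} = 1" if "q \<in> UNIV - {p}" for q
    using young_line_through[of p q] that by simp
  ultimately have "card (UNIV - {p}) = 2 * card ?T" by simp
  moreover have "card (UNIV - {p}) = 8"
    using card_young_points by (simp add: young_points_def card_Diff_singleton)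
  ultimately show ?thesis by simp
qed

lemma card_young_lines: "card young_lines = 12"
proof -
  have "(\<Sum>q\<in>UNIV. card {l \<in> young_lines. q \<in> l}) = 3 * card young_lines"
    by (rule sum_multicount) (auto simp: card_young_line)
  then show ?thesis
    using card_young_points by (simp add: card_young_lines_through young_points_def)
qed

lemma configuration_young: "configuration young_points young_lines"
  unfolding configuration_def
proof (intro conjI ballI impI)
  fix p q l m
  assume "p \<noteq> q" "l \<in> young_lines" "m \<in> young_lines" "{p, q} \<subseteq> l \<and> {p, q} \<subseteq> m"
  then have "l \<in> {l \<in> young_lines. p \<in> l \<and> q \<in> l}" "m \<in> {l \<in> young_lines. p \<in> l \<and> q \<in> l}"
    by auto
  then show "l = m" unfolding young_line_through[OF \<open>p \<noteq> q\<close>] by simp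
next
  show "\<exists>r. \<forall>p\<in>young_points. card {l \<in> young_lines. p \<in> l} = r"
    by (simp add: card_young_lines_through)
next
  show "\<exists>k. \<forall>l\<in>young_lines. card l = k"
    by (simp add: card_young_line)
qed (simp_all add: young_points_def card_young_points[unfolded young_points_def])

end

theory Submission
  imports Defs
begin

text \<open>The twelve lines fall into four parallel classes, and the lines of a triangle have three
  different directions. Coloring the two axis-parallel classes red and the two diagonal classes
  blue therefore leaves no monochromatic triangle.\<close>

lemma num3_mult_eq_0_iff: "(x :: 3) * y = 0 \<longleftrightarrow> x = 0 \<or> y = 0"
  using exhaust_3[of x] exhaust_3[of y] by auto

text \<open>A color depends on the line as a set, and \<open>a\<close>, \<open>v\<close> in
  \<open>affine_line a v\<close> are not unique, so the direction is read off from points of the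
  line.\<close>

definition axis_parallel :: "(3 ^ 2) set \<Rightarrow> bool" where
  "axis_parallel l \<longleftrightarrow> (\<exists>p\<in>l. \<exists>q\<in>l. p \<noteq> q \<and> (p $ 1 = q $ 1 \<or> p $ 2 = q $ 2))"

text \<open>The difference \<open>p - q\<close> is a nonzero multiple of \<open>v\<close>, so both
  vanish in the same coordinates. Hence every pair of distinct points of a line gives the same
  answer.\<close>

lemma axis_parallel_affine_line:
  assumes "p \<noteq> q" "p \<in> affine_line a v" "q \<in> affine_line a v"
  shows "p $ 1 = q $ 1 \<or> p $ 2 = q $ 2 \<longleftrightarrow> v $ 1 = 0 \<or> v $ 2 = 0"
proof -
  obtain s t where s: "p = a + s *s v" and t: "q = a + t *s v"
    using assms by (auto simp: affine_line_def)
  have "s - t \<noteq> 0" using assms(1) s t by auto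
  moreover have "p $ i - q $ i = (s - t) * v $ i" for i
    unfolding s t by (simp add: algebra_simps)
  ultimately have "p $ i = q $ i \<longleftrightarrow> v $ i = 0" for i
    by (metis eq_iff_diff_eq_0 num3_mult_eq_0_iff)
  then show ?thesis by simp
qed

lemma axis_parallel_iff:
  assumes "l \<in> young_lines" "p \<in> l" "q \<in> l" "p \<noteq> q"
  shows "axis_parallel l \<longleftrightarrow> p $ 1 = q $ 1 \<or> p $ 2 = q $ 2"
proof -
  obtain a v where l: "l = affine_line a v" using assms by (auto simp: young_lines_def)
  show ?thesis
    using axis_parallel_affine_line[of _ _ a v] assms unfolding axis_parallel_def l by metis
qed

text \<open>Meant for two side vectors x, y of a triangle and the third side x + y: if all three are
  axis-parallel or none is, the triangle degenerates. When x lies along one axis and y off it, y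
  must lie along the other, and then x + y has no zero coordinate.\<close>

lemma num3_same_direction:
  fixes x1 x2 y1 y2 :: 3
  assumes "x1 \<noteq> 0 \<or> x2 \<noteq> 0"
    and "x1 = 0 \<or> x2 = 0 \<longleftrightarrow> y1 = 0 \<or> y2 = 0"
    and "x1 = 0 \<or> x2 = 0 \<longleftrightarrow> x1 + y1 = 0 \<or> x2 + y2 = 0"
  shows "\<exists>t. y1 = t * x1 \<and> y2 = t * x2"
proof (cases "x1 = 0 \<or> x2 = 0")
  case True
  then consider "x1 = 0" "x2 \<noteq> 0" "y1 = 0" | "x2 = 0" "x1 \<noteq> 0" "y2 = 0"
    using assms by fastforce
  then show ?thesis
  proof cases
    case 1
    \<comment> \<open>The factor is the quotient of \<open>y2\<close> by \<open>x2\<close>; nonzero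
      elements modulo 3 are their own inverses.\<close>
    then have "y1 = y2 * x2 * x1 \<and> y2 = y2 * x2 * x2"
      by (simp add: num3_inverse mult.assoc)
    then show ?thesis by blast
  next
    case 2
    then have "y1 = y1 * x1 * x1 \<and> y2 = y1 * x1 * x2"
      by (simp add: num3_inverse mult.assoc)
    then show ?thesis by blast
  qed
next
  case False
  \<comment> \<open>The only nonzero elements are 1 and -1, and these cancel, so a nonzero sum
    forces equality.\<close>
  have "y = x" if "x \<noteq> 0" "y \<noteq> 0" "x + y \<noteq> 0" for x y :: 3
    using that exhaust_3[of x] exhaust_3[of y] by auto
  then have "y1 = 1 * x1 \<and> y2 = 1 * x2" using False assms by simp
  then show ?thesis by blast
qed

text \<open>Otherwise the sides \<open>q - p\<close> and \<open>r - q\<close> would be proportional,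
  which puts \<open>r\<close> on the line \<open>l\<close> through \<open>p\<close> and
  \<open>q\<close>.\<close>

lemma triangle_not_all_axis_parallel_or_diagonal:
  assumes T: "triangle_lines young_lines p q r l m n"
    and "axis_parallel l = axis_parallel m" "axis_parallel m = axis_parallel n"
  shows False
proof -
  have L: "l \<in> young_lines" "m \<in> young_lines" "n \<in> young_lines"
    and I: "p \<in> l" "q \<in> l" "r \<notin> l" "q \<in> m" "r \<in> m" "p \<notin> m" "p \<in> n" "r \<in> n" "q \<notin> n"
    using T by (auto simp: triangle_lines_def)
  have D: "p \<noteq> q" "q \<noteq> r" "p \<noteq> r" using I by auto
  note iffs = axis_parallel_iff[OF L(1) I(1,2) D(1)] axis_parallel_iff[OF L(2) I(4,5) D(2)]
    axis_parallel_iff[OF L(3) I(7,8) D(3)]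
  let ?x = "q - p"
  \<comment> \<open>Oriented so that vanishing coordinates of side vectors turn into exactly the
    equations in \<open>iffs\<close>.\<close>
  have diff_eq_0: "(b - a) $ i = 0 \<longleftrightarrow> a $ i = b $ i" for a b :: "3 ^ 2" and i
    unfolding vector_minus_component right_minus_eq by (rule eq_commute)
  have "?x $ i + (r - q) $ i = (r - p) $ i" for i
    by (simp add: algebra_simps)
  note eqs = this diff_eq_0
  have "\<exists>t. (r - q) $ 1 = t * ?x $ 1 \<and> (r - q) $ 2 = t * ?x $ 2"
  proof (rule num3_same_direction)
    show "?x $ 1 \<noteq> 0 \<or> ?x $ 2 \<noteq> 0"
      unfolding eqs using D(1) by (simp add: vec_eq_iff forall_2)
    show "?x $ 1 = 0 \<or> ?x $ 2 = 0 \<longleftrightarrow> (r - q) $ 1 = 0 \<or> (r - q) $ 2 = 0"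
      unfolding eqs using iffs assms(2) by blast
    show "?x $ 1 = 0 \<or> ?x $ 2 = 0 \<longleftrightarrow>
        ?x $ 1 + (r - q) $ 1 = 0 \<or> ?x $ 2 + (r - q) $ 2 = 0"
      unfolding eqs using iffs assms(2,3) by blast
  qed
  then obtain t where "(r - q) $ 1 = t * ?x $ 1" "(r - q) $ 2 = t * ?x $ 2" by blast
  \<comment> \<open>Here \<open>r - p\<close> is the sum of \<open>q - p\<close> and
    \<open>r - q\<close>, that is, of \<open>?x\<close> and its \<open>t\<close>-fold.\<close>
  then have "r = p + (1 + t) *s ?x"
    by (simp add: vec_eq_iff forall_2 algebra_simps)
  then have "r \<in> affine_line p ?x" unfolding affine_line_def by blast
  moreover have "l = affine_line p ?x"
    using young_line_through[OF D(1)] L(1) I(1,2) by (metis (mono_tags, lifting) mem_Collect_eq singletonD)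
  ultimately show False using I(3) by simp
qed

theorem theorem4p3:
  shows "min_monochromatic_triangles young_points young_lines = 0"
proof -
  \<comment> \<open>The restriction supplies the value \<open>undefined\<close> off the lines, as
    membership in \<open>line_2_colorings\<close> demands.\<close>
  define c where "c = restrict (\<lambda>l. if axis_parallel l then Red else Blue) young_lines"
  have c: "c \<in> line_2_colorings young_lines"
    by (auto simp: c_def line_2_colorings_def)
  have "\<not> (triangle_lines young_lines p q r l m n \<and> c l = c m \<and> c m = c n)" for p q r l m n
    using triangle_not_all_axis_parallel_or_diagonal[of p q r l m n]
    by (auto simp: c_def triangle_lines_def split: if_splits)
  then have "card (monochromatic_triangles young_points young_lines c) = 0"
    unfolding monochromatic_triangles_def by simp
  then have "0 \<in> (\<lambda>c. card (monochromatic_triangles young_points young_lines c)) `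
      line_2_colorings young_lines"
    using c by (metis image_eqI)
  \<comment> \<open>Finiteness makes \<open>Min\<close> a lower bound of the counts; since 0 is
    among them, the minimum is 0.\<close>
  moreover have "finite (line_2_colorings young_lines)"
    by (simp add: line_2_colorings_finite_nonempty)
  ultimately show ?thesis
    unfolding min_monochromatic_triangles_def using Min_le by (metis finite_imageI le_zero_eq)
qed

end
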